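(* Let $R(x)=1+\frac{a}{x}$ and $S(x)=\frac{x}{b}$, where $a>0$ and $b>1$. Then for any $(x,y)\in(0,\infty)^2$, the closure (in $[0,\infty)^2$) of the orbit $\{(h(x),h(y)): h\in\langle R,S\rangle\}$ of $(x,y)$ under the induced action of $\langle R,S\rangle$ equals $$\bigcup_{k\in\mathbb{Z}}\Omega(b^kx,b^ky).$$
   Context: $\langle R,S\rangle$ is the semigroup of all finite compositions of $R$ and $S$ (including the identity), acting on $(0,\infty)^2$ coordinatewise: $h(x,y)=(h(x),h(y))$. For $A=(x,y)\in(0,\infty)^2$, $H(x,y)$ denotes the segment, from the origin to $A$, of the unique hyperbola tangent to the line $y=x$ at the origin and passing through $A$ (i.e. the curve $1/v-1/u=1/y-1/x$); $L(x,y)$ denotes the half-line of slope $1$ in $(0,\infty)^2$ starting at $(x,y)$ and going to infinity. For $x\neq y$, $\Omega(x,y)$ is the closed region bounded by $H(x,y)$, $L(x,y)$, $H(a/x,a/y)$ and $L(a/x,a/y)$; for $x=y$, $\Omega(x,x)=\{(t,t):t\ge0\}$. Explicitly, for $x>y$: $\Omega(x,y)=\{(0,0)\}\cup\{(u,v)\in(0,\infty)^2: u\ge v,\ u-v\le x-y,\ \tfrac1v-\tfrac1u\le \tfrac1y-\tfrac1x\}\cup\{(u,v)\in(0,\infty)^2: v\ge u,\ v-u\le \tfrac ay-\tfrac ax,\ \tfrac1u-\tfrac1v\le\tfrac{x-y}{a}\}$, and for $x<y$, $\Omega(x,y)=\Omega(a/x,a/y)$. *)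

theory Defs
  imports "HOL-Analysis.Analysis"
begin

definition R_map :: "real \<Rightarrow> real \<Rightarrow> real" where
  "R_map a x = 1 + a / x"

definition S_map :: "real \<Rightarrow> real \<Rightarrow> real" where
  "S_map b x = x / b"

text \<open>For \<open>a, b > 0\<close> the generators map \<open>(0,\<infinity>)\<close> into itself, so values of
  elements of the semigroup at nonpositive reals never influence the orbit of a positive point.\<close>

inductive_set RS_semigroup :: "real \<Rightarrow> real \<Rightarrow> (real \<Rightarrow> real) set" for a b :: real where
  RS_id: "id \<in> RS_semigroup a b"
| RS_R: "h \<in> RS_semigroup a b \<Longrightarrow> R_map a \<circ> h \<in> RS_semigroup a b"
| RS_S: "h \<in> RS_semigroup a b \<Longrightarrow> S_map b \<circ> h \<in> RS_semigroup a b"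

definition RS_orbit :: "real \<Rightarrow> real \<Rightarrow> real \<times> real \<Rightarrow> (real \<times> real) set" where
  "RS_orbit a b p = {(h (fst p), h (snd p)) | h. h \<in> RS_semigroup a b}"

text \<open>The region for \<open>x > y > 0\<close>. Let \<open>H(x,y)\<close> be the arc from the origin to \<open>(x,y)\<close> of
  the hyperbola \<open>1/v - 1/u = 1/y - 1/x\<close>, which is tangent to the diagonal at the origin, and
  \<open>L(x,y)\<close> the half-line of slope 1 from \<open>(x,y)\<close> to infinity. On and below the diagonal the
  region is bounded by \<open>H(x,y)\<close> and \<open>L(x,y)\<close>. On and above the diagonal it is bounded by
  \<open>H(a/x,a/y)\<close> and \<open>L(a/x,a/y)\<close>; there the hyperbola is \<open>1/u - 1/v = (x - y)/a\<close>.\<close>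

definition Omega_below :: "real \<Rightarrow> real \<Rightarrow> real \<Rightarrow> (real \<times> real) set" where
  "Omega_below a x y =
     {(0, 0)}
     \<union> {(u, v). u > 0 \<and> v > 0 \<and> u \<ge> v \<and> u - v \<le> x - y \<and> 1 / v - 1 / u \<le> 1 / y - 1 / x}
     \<union> {(u, v). u > 0 \<and> v > 0 \<and> v \<ge> u \<and> v - u \<le> a / y - a / x \<and> 1 / u - 1 / v \<le> (x - y) / a}"

definition Omega :: "real \<Rightarrow> real \<Rightarrow> real \<Rightarrow> (real \<times> real) set" where
  "Omega a x y =
     (if x = y then {(t, t) | t. t \<ge> 0}
      else if x > y then Omega_below a x y
      else Omega_below a (a / x) (a / y))"

end

(* The orbit closure is invariant under R and S, hence, being closed, under every pointwise limit
   of their compositions.  Since S^n R S^n x = b^(-n) + a/x, the inversion x -> a/x is such a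
   limit; conjugating by it gives S^(-1) and the translations by b^(-n), hence all nonnegative
   translations, and again by conjugation all maps x -> x / (1 + s x) with s >= 0.  The latter move
   (x, y) along H(x, y) to the origin, the translations move it along half-lines L, and the two
   together sweep out Omega(x, y).  Conversely the union of the regions is closed and is mapped
   into itself by R and S. *)
theory Submission
  imports Defs "HOL-Real_Asymp.Real_Asymp"
begin

section \<open>Maps preserving a closed set of pairs\<close>

text \<open>Only positive arguments are tested, since a closed set may contain the origin, where
  \<open>R_map a\<close> has the value 1 by the convention \<open>a / 0 = 0\<close>. Positivity of
  \<open>g\<close> makes the notion stable under composition.\<close>

definition preserves :: "(real \<times> real) set \<Rightarrow> (real \<Rightarrow> real) \<Rightarrow> bool" where
  "preserves C g \<longleftrightarrow> (\<forall>x>0. g x > 0) \<and> (\<forall>x>0. \<forall>y>0. (x, y) \<in> C \<longrightarrow> (g x, g y) \<in> C)"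

lemma preservesD:
  assumes "preserves C g" "x > 0" "y > 0" "(x, y) \<in> C"
  shows "(g x, g y) \<in> C"
  using assms by (auto simp: preserves_def)

lemma preserves_comp:
  assumes "preserves C g" "preserves C h"
  shows "preserves C (\<lambda>x. g (h x))"
  using assms by (auto simp: preserves_def)

lemma preserves_cong:
  assumes "preserves C g" "\<And>x. x > 0 \<Longrightarrow> g x = h x"
  shows "preserves C h"
  using assms by (auto simp: preserves_def)

lemma preserves_funpow:
  assumes "preserves C g"
  shows "preserves C (g ^^ n)"
proof (induction n)
  case 0
  then show ?case by (simp add: preserves_def)
next
  case (Suc n)
  then show ?case using preserves_comp[OF assms Suc] by (simp add: o_def)
qed

text \<open>The pairs of values stay in \<open>C\<close> and converge. Positivity of
  \<open>h\<close> is a hypothesis because positive values may tend to 0.\<close>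

lemma preserves_limit:
  assumes "closed C" "\<And>n::nat. preserves C (g n)"
    and lim: "\<And>x. x > 0 \<Longrightarrow> (\<lambda>n. g n x) \<longlonglongrightarrow> h x"
    and pos: "\<And>x. x > 0 \<Longrightarrow> h x > 0"
  shows "preserves C h"
  unfolding preserves_def
proof (intro conjI allI impI pos)
  fix x y :: real assume "x > 0" "y > 0" "(x, y) \<in> C"
  then have "\<And>n. (g n x, g n y) \<in> C"
    and "(\<lambda>n. (g n x, g n y)) \<longlonglongrightarrow> (h x, h y)"
    using assms(2) by (auto intro!: tendsto_Pair lim simp: preserves_def)
  then show "(h x, h y) \<in> C"
    by (rule closed_sequentially[OF \<open>closed C\<close>, of "\<lambda>n. (g n x, g n y)"])
qed

text \<open>Members of \<open>C\<close> approximating a positive pair are positive themselves, so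
  \<open>g\<close> keeps them in \<open>C\<close>, and continuity passes to the limit.\<close>

lemma preserves_closure:
  assumes "preserves C g" "continuous_on {0<..} g" "C \<subseteq> {0<..} \<times> {0<..}"
  shows "preserves (closure C) g"
  unfolding preserves_def
proof (intro conjI allI impI)
  fix x :: real assume "x > 0"
  then show "g x > 0" using assms(1) by (simp add: preserves_def)
next
  fix x y :: real assume xy: "x > 0" "y > 0" "(x, y) \<in> closure C"
  then obtain p where p: "\<And>n. p n \<in> C" "p \<longlonglongrightarrow> (x, y)"
    by (auto simp: closure_sequential)
  have "isCont g x" "isCont g y"
    using assms(2) xy by (auto simp: continuous_on_eq_continuous_at)
  then have "(\<lambda>n. (g (fst (p n)), g (snd (p n)))) \<longlonglongrightarrow> (g x, g y)"
    using isCont_tendsto_compose[OF _ tendsto_fst[OF p(2)], of g]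
      isCont_tendsto_compose[OF _ tendsto_snd[OF p(2)], of g]
    by (simp add: tendsto_Pair)
  moreover have "(g (fst (p n)), g (snd (p n))) \<in> C" for n
  proof -
    have "(fst (p n), snd (p n)) \<in> C" using p(1) by simp
    moreover have "fst (p n) > 0" "snd (p n) > 0"
      using p(1)[of n] assms(3) by auto
    ultimately show ?thesis using assms(1) preservesD by blast
  qed
  ultimately show "(g x, g y) \<in> closure C"
    unfolding closure_sequential by (intro exI[of _ "\<lambda>n. (g (fst (p n)), g (snd (p n)))"]) auto
qed

section \<open>The regions in terms of their two parameters\<close>

text \<open>Clearing denominators in the hyperbola inequality makes the set closed and absorbs the origin;
  it contains no other point of the axes.\<close>

definition sector :: "real \<Rightarrow> real \<Rightarrow> (real \<times> real) set" where
  "sector D E = {(u, v). 0 \<le> v \<and> v \<le> u \<and> u - v \<le> D \<and> u - v \<le> E * (u * v)}"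

text \<open>For \<open>a > 0\<close>, inversion \<open>x -> a / x\<close> reverses order and turns
  the bounds \<open>D\<close> on the difference and \<open>E\<close> on the difference of
  reciprocals into \<open>a * E\<close> and \<open>D / a\<close>. Apart from the origin, the second
  half is thus the inverted first half.\<close>

definition region :: "real \<Rightarrow> real \<Rightarrow> real \<Rightarrow> (real \<times> real) set" where
  "region a D E = sector D E \<union> prod.swap -` sector (a * E) (D / a)"

lemma closed_sector: "closed (sector D E)"
proof -
  have "sector D E = {p. 0 \<le> snd p} \<inter> {p. snd p \<le> fst p} \<inter> {p. fst p - snd p \<le> D}
      \<inter> {p. fst p - snd p \<le> E * (fst p * snd p)}"
    by (auto simp: sector_def)
  then show ?thesis
    by (auto intro!: closed_Int closed_Collect_le continuous_intros)
qed

text \<open>Multiplying by \<open>u * v > 0\<close> relates the two forms; \<open>v = 0\<close>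
  forces \<open>u = 0\<close>, and the origin belongs to the sector because
  \<open>D \<ge> 0\<close>.\<close>

lemma sector_altdef:
  assumes "D \<ge> 0"
  shows "sector D E = {(0, 0)} \<union> {(u, v). u > 0 \<and> v > 0 \<and> u \<ge> v \<and> u - v \<le> D \<and> 1 / v - 1 / u \<le> E}"
proof -
  have *: "1 / v - 1 / u \<le> E \<longleftrightarrow> u - v \<le> E * (u * v)" if "u > 0" "v > 0" for u v
  proof -
    have "1 / v - 1 / u = (u - v) / (u * v)" using that by (simp add: diff_frac_eq mult.commute)
    then show ?thesis using that by (simp add: pos_divide_le_eq)
  qed
  have "(u, v) \<in> sector D E \<longleftrightarrow>
      (u, v) = (0, 0) \<or> u > 0 \<and> v > 0 \<and> u \<ge> v \<and> u - v \<le> D \<and> 1 / v - 1 / u \<le> E" for u v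
  proof (cases "v > 0")
    case True
    then show ?thesis using * by (auto simp: sector_def)
  next
    case False
    then show ?thesis using assms by (auto simp: sector_def)
  qed
  then show ?thesis by auto
qed

lemma Omega_below_eq_region:
  assumes "a > 0" "y > 0" "x \<ge> y"
  shows "Omega_below a x y = region a (x - y) (1 / y - 1 / x)"
proof -
  have "1 / y - 1 / x \<ge> 0" using assms by (simp add: frac_le)
  then have D: "x - y \<ge> 0" "a * (1 / y - 1 / x) \<ge> 0"
    using assms by (simp, intro mult_nonneg_nonneg) simp_all
  have mem_sector:
    "(u, v) \<in> sector (x - y) (1 / y - 1 / x) \<longleftrightarrow> (u, v) = (0, 0) \<or>
      u > 0 \<and> v > 0 \<and> u \<ge> v \<and> u - v \<le> x - y \<and> 1 / v - 1 / u \<le> 1 / y - 1 / x"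
    "(v, u) \<in> sector (a * (1 / y - 1 / x)) ((x - y) / a) \<longleftrightarrow> (u, v) = (0, 0) \<or>
      u > 0 \<and> v > 0 \<and> v \<ge> u \<and> v - u \<le> a / y - a / x \<and> 1 / u - 1 / v \<le> (x - y) / a" for u v
    unfolding sector_altdef[OF D(1)] sector_altdef[OF D(2)] by (auto simp: right_diff_distrib)
  have "(u, v) \<in> Omega_below a x y \<longleftrightarrow> (u, v) \<in> region a (x - y) (1 / y - 1 / x)" for u v
    unfolding region_def Omega_below_def Un_iff vimage_eq swap_simp mem_sector
      mem_Collect_eq case_prod_conv singleton_iff by argo
  then show ?thesis by auto
qed

lemma region_0: "region a 0 0 = {(t, t) | t. t \<ge> 0}"
  by (auto simp: region_def sector_def)

text \<open>For equal coordinates both parameters vanish and the region is the diagonal ray, so the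
  separate clause of \<open>Omega\<close> fits the common formula.\<close>

lemma Omega_eq_region:
  assumes "a > 0" "y > 0" "x \<ge> y"
  shows "Omega a x y = region a (x - y) (1 / y - 1 / x)"
  using assms Omega_below_eq_region[OF assms] by (auto simp: Omega_def region_0)

text \<open>The clause for \<open>x < y\<close> is defined through inversion, an involution; this
  reduces later arguments to \<open>x \<ge> y\<close>.\<close>

lemma Omega_inversion:
  assumes "a > 0" "x > 0" "y > 0"
  shows "Omega a (a / x) (a / y) = Omega a x y"
  using assms by (auto simp: Omega_def field_simps)

section \<open>Closed invariant sets contain the regions\<close>

locale RS_invariant =
  fixes a b :: real and C :: "(real \<times> real) set"
  assumes a_pos: "a > 0" and b_gt_1: "b > 1" and closed: "closed C"
    and preserves_R: "preserves C (R_map a)" and preserves_S: "preserves C (S_map b)"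
begin

section \<open>Maps obtained as limits of compositions\<close>

lemma S_funpow: "(S_map b ^^ n) x = x / b ^ n"
  using b_gt_1 by (induction n) (auto simp: S_map_def field_simps)

lemma preserves_shifted_inversion: "preserves C (\<lambda>x. 1 / b ^ n + a / x)"
proof -
  have "preserves C (\<lambda>x. (S_map b ^^ n) (R_map a ((S_map b ^^ n) x)))"
    by (rule preserves_comp[OF preserves_funpow[OF preserves_S]
          preserves_comp[OF preserves_R preserves_funpow[OF preserves_S]]])
  then show ?thesis
    by (rule preserves_cong) (use b_gt_1 in \<open>simp add: S_funpow R_map_def field_simps\<close>)
qed

lemma inverse_powers_tendsto_0: "(\<lambda>n. 1 / b ^ n) \<longlonglongrightarrow> 0"
  using LIMSEQ_inverse_realpow_zero[OF b_gt_1] by (simp add: inverse_eq_divide)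

lemma preserves_inversion: "preserves C (\<lambda>x. a / x)"
proof (rule preserves_limit[OF closed preserves_shifted_inversion])
  fix x :: real
  show "(\<lambda>n. 1 / b ^ n + a / x) \<longlonglongrightarrow> a / x"
    using tendsto_add[OF inverse_powers_tendsto_0 tendsto_const[of "a / x"]] by simp
qed (use a_pos in auto)

lemma preserves_S_inverse: "preserves C (\<lambda>x. b * x)"
  using preserves_comp[OF preserves_inversion preserves_comp[OF preserves_S preserves_inversion]]
  by (rule preserves_cong) (use a_pos b_gt_1 in \<open>simp add: S_map_def field_simps\<close>)

lemma preserves_power_int: "preserves C (\<lambda>x. b powi k * x)"
proof -
  have "((\<lambda>x. b * x) ^^ n) = (\<lambda>x. b ^ n * x)" for n
    by (induction n) (auto simp: mult.assoc)
  then have "preserves C (\<lambda>x. b ^ n * x)" for n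
    by (metis preserves_funpow[OF preserves_S_inverse])
  moreover have "preserves C (\<lambda>x. x / b ^ n)" for n
    using preserves_funpow[OF preserves_S, of n] S_funpow by (metis preserves_cong)
  ultimately show ?thesis
    by (cases "k \<ge> 0") (simp_all add: power_int_def divide_inverse power_inverse mult.commute)
qed

lemma preserves_small_translation: "preserves C (\<lambda>x. x + 1 / b ^ n)"
  using preserves_comp[OF preserves_shifted_inversion preserves_inversion]
  by (rule preserves_cong) (use a_pos in \<open>simp add: field_simps\<close>)

lemma preserves_translation:
  assumes "t \<ge> 0"
  shows "preserves C (\<lambda>x. x + t)"
proof -
  \<comment> \<open>\<open>m n\<close> translations by \<open>1 / b ^ n\<close> add up to a shift
    between \<open>t - 1 / b ^ n\<close> and \<open>t\<close>.\<close>
  define m where "m n = nat \<lfloor>t * b ^ n\<rfloor>" for n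
  have m: "real (m n) \<le> t * b ^ n" "t * b ^ n - 1 \<le> real (m n)" for n
  proof -
    have "t * b ^ n \<ge> 0" using assms b_gt_1 by simp
    then have "real (m n) = of_int \<lfloor>t * b ^ n\<rfloor>" by (simp add: m_def)
    then show "real (m n) \<le> t * b ^ n" "t * b ^ n - 1 \<le> real (m n)" by linarith+
  qed
  have "((\<lambda>x. x + c) ^^ j) = (\<lambda>x. x + real j * c)" for c :: real and j
    by (induction j) (auto simp: algebra_simps)
  then have pres: "preserves C (\<lambda>x. x + real (m n) * (1 / b ^ n))" for n
    by (metis preserves_funpow[OF preserves_small_translation])
  have lim: "(\<lambda>n. real (m n) * (1 / b ^ n)) \<longlonglongrightarrow> t"
  proof (rule tendsto_sandwich)
    show "(\<lambda>n. t - 1 / b ^ n) \<longlonglongrightarrow> t"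
      using tendsto_diff[OF tendsto_const[of t] inverse_powers_tendsto_0] by simp
    show "\<forall>\<^sub>F n in sequentially. t - 1 / b ^ n \<le> real (m n) * (1 / b ^ n)"
    proof (intro always_eventually allI)
      fix n
      have "t - 1 / b ^ n = (t * b ^ n - 1) / b ^ n" using b_gt_1 by (simp add: field_simps)
      also have "\<dots> \<le> real (m n) / b ^ n" using m(2) b_gt_1 by (intro divide_right_mono) auto
      finally show "t - 1 / b ^ n \<le> real (m n) * (1 / b ^ n)" by simp
    qed
    show "\<forall>\<^sub>F n in sequentially. real (m n) * (1 / b ^ n) \<le> t"
      using m(1) b_gt_1 by (simp add: pos_divide_le_eq)
  qed auto
  show ?thesis
    by (rule preserves_limit[OF closed pres tendsto_add[OF tendsto_const lim]]) (use assms in simp)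
qed

text \<open>Conjugating the translation by \<open>a * s\<close> with inversion adds \<open>s\<close>
  to every reciprocal, so \<open>1 / y - 1 / x\<close> is constant along this flow.\<close>

lemma preserves_hyperbolic_flow:
  assumes "s \<ge> 0"
  shows "preserves C (\<lambda>x. x / (1 + s * x))"
proof -
  have "preserves C (\<lambda>x. a / (a / x + a * s))"
    by (intro preserves_comp[OF preserves_inversion]
        preserves_comp[OF preserves_translation preserves_inversion])
      (use assms a_pos in simp)
  moreover have "a / (a / x + a * s) = x / (1 + s * x)" if "x > 0" for x
  proof -
    have "a / x + a * s = a * ((1 + s * x) / x)" using that by (simp add: field_simps)
    then show ?thesis using a_pos by simp
  qed
  ultimately show ?thesis by (rule preserves_cong)
qed

text \<open>The flow sends every point to 0 as its time grows; translating by \<open>u\<close>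
  before taking the limit keeps the limit positive.\<close>

lemma preserves_const:
  assumes "u > 0"
  shows "preserves C (\<lambda>x. u)"
proof (rule preserves_limit[OF closed])
  show "preserves C (\<lambda>x. x / (1 + real n * x) + u)" for n
    by (intro preserves_comp[OF preserves_translation] preserves_hyperbolic_flow)
      (use assms in auto)
  fix x :: real assume "x > 0"
  then have "(\<lambda>n. x / (1 + real n * x)) \<longlonglongrightarrow> 0"
    by real_asymp
  then show "(\<lambda>n. x / (1 + real n * x) + u) \<longlonglongrightarrow> u"
    using tendsto_add[OF _ tendsto_const[of u]] by (metis add_0)
qed (use assms in auto)

section \<open>Sweeping out the regions\<close>

lemma diagonal_mem:
  assumes "x > 0" "y > 0" "(x, y) \<in> C" "u \<ge> 0"
  shows "(u, u) \<in> C"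
proof -
  have pos: "(u, u) \<in> C" if "u > 0" for u
    using preservesD[OF preserves_const[OF that] assms(1-3)] .
  \<comment> \<open>The positive offset lets the constant maps apply, so that the limit also covers
    \<open>u = 0\<close>.\<close>
  have "(\<lambda>n. (u + inverse (real (Suc n)), u + inverse (real (Suc n)))) \<longlonglongrightarrow> (u + 0, u + 0)"
    by (intro tendsto_intros LIMSEQ_inverse_real_of_nat)
  then have lim: "(\<lambda>n. (u + inverse (real (Suc n)), u + inverse (real (Suc n)))) \<longlonglongrightarrow> (u, u)"
    by (simp only: add_0_right)
  have "(u + inverse (real (Suc n)), u + inverse (real (Suc n))) \<in> C" for n
    using \<open>u \<ge> 0\<close> by (intro pos add_nonneg_pos) auto
  then show ?thesis using lim
    by (rule closed_sequentially[OF closed,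
        of "\<lambda>n. (u + inverse (real (Suc n)), u + inverse (real (Suc n)))"])
qed

text \<open>A point off the diagonal is reached by flowing \<open>(x, y)\<close> along its hyperbola
  until the coordinate difference is \<open>u - v\<close>, then translating. The hyperbola bound
  ensures that the translation is by a nonnegative amount.\<close>

lemma sector_subset:
  assumes "y > 0" "x \<ge> y" "(x, y) \<in> C"
  shows "sector (x - y) (1 / y - 1 / x) \<subseteq> C"
proof
  fix p assume "p \<in> sector (x - y) (1 / y - 1 / x)"
  then obtain u v where p: "p = (u, v)"
    and uv: "0 \<le> v" "v \<le> u" "u - v \<le> x - y" "u - v \<le> (1 / y - 1 / x) * (u * v)"
    by (auto simp: sector_def)
  show "p \<in> C"
  proof (cases "u = v")
    case True
    then show ?thesis using diagonal_mem[of x y] assms uv p by auto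
  next
    case False
    \<comment> \<open>If \<open>v = 0\<close>, the hyperbola bound reads \<open>u \<le> 0\<close>,
      which gives \<open>u = v\<close>.\<close>
    with uv have "v > 0" "u > v" by (auto intro: less_le[THEN iffD2])
    have "x > 0" using assms by simp
    \<comment> \<open>The coordinate difference at time \<open>s\<close>: it starts at
      \<open>x - y \<ge> u - v\<close> and tends to 0, so it equals \<open>u - v\<close> at some
      time.\<close>
    define \<delta> where "\<delta> s = x / (1 + s * x) - y / (1 + s * y)" for s
    have "((\<lambda>s. x / (1 + s * x) - y / (1 + s * y)) \<longlongrightarrow> 0) at_top"
      using \<open>x > 0\<close> \<open>y > 0\<close> by real_asymp
    then have "\<forall>\<^sub>F s in at_top. \<delta> s < u - v"
      unfolding \<delta>_def using \<open>u > v\<close> by (intro order_tendstoD) auto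
    then obtain s0 where s0: "s0 \<ge> 0" "\<delta> s0 < u - v"
      using eventually_happens[OF eventually_conj[OF eventually_ge_at_top[of 0]]] by fastforce
    have "continuous_on {0..s0} \<delta>"
      unfolding \<delta>_def using \<open>x > 0\<close> \<open>y > 0\<close>
      by (intro continuous_intros) (auto simp: add_pos_nonneg less_imp_neq[symmetric])
    then obtain s where s: "s \<ge> 0" "\<delta> s = u - v"
      using IVT2'[of \<delta> s0 "u - v" 0] s0 uv by (auto simp: \<delta>_def)
    define x' y' where "x' = x / (1 + s * x)" and "y' = y / (1 + s * y)"
    have pos: "x' > 0" "y' > 0"
      using s \<open>x > 0\<close> \<open>y > 0\<close> by (auto simp: x'_def y'_def add_pos_nonneg)
    have C': "(x', y') \<in> C"
      using preservesD[OF preserves_hyperbolic_flow[OF s(1)] \<open>x > 0\<close> \<open>y > 0\<close> assms(3)]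
      by (simp add: x'_def y'_def)
    have diff: "x' - y' = u - v" using s by (simp add: \<delta>_def x'_def y'_def)
    have "1 / x' = 1 / x + s" "1 / y' = 1 / y + s"
      using \<open>x > 0\<close> \<open>y > 0\<close> s by (auto simp: x'_def y'_def field_simps)
    then have "1 / y - 1 / x = 1 / y' - 1 / x'" by simp
    also have "\<dots> = (u - v) / (x' * y')" using diff pos by (simp add: field_simps)
    finally have "u - v \<le> (u - v) * (u * v) / (x' * y')" using uv by simp
    then have "(u - v) * (x' * y') \<le> (u - v) * (u * v)" using pos by (simp add: pos_le_divide_eq)
    then have "x' * y' \<le> u * v" using \<open>u > v\<close> by simp
    \<comment> \<open>As the differences agree, \<open>y' > v\<close> would force
      \<open>x' > u\<close> and hence a larger product.\<close>
    have "y' \<le> v"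
    proof (rule ccontr)
      assume "\<not> y' \<le> v"
      then have "u * v < x' * y'"
        using diff \<open>v > 0\<close> \<open>u > v\<close> by (intro mult_strict_mono) auto
      with \<open>x' * y' \<le> u * v\<close> show False by simp
    qed
    then have "(x' + (v - y'), y' + (v - y')) \<in> C"
      using preservesD[OF preserves_translation pos C', of "v - y'"] by simp
    moreover have "x' + (v - y') = u" using diff by simp
    ultimately show ?thesis using p by simp
  qed
qed

text \<open>Inversion carries positive points of the second half into the sector already covered,
  and a second inversion brings them back. The origin is treated as a diagonal point.\<close>

lemma region_subset:
  assumes "y > 0" "x \<ge> y" "(x, y) \<in> C"
  shows "region a (x - y) (1 / y - 1 / x) \<subseteq> C"
proof -
  have "(u, v) \<in> C" if "(v, u) \<in> sector (a * (1 / y - 1 / x)) ((x - y) / a)" for u v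
  proof (cases "u > 0 \<and> v > 0")
    case True
    with that have h: "u \<le> v" "v - u \<le> a * (1 / y - 1 / x)" "v - u \<le> (x - y) / a * (v * u)"
      by (auto simp: sector_def)
    have diff: "a / u - a / v = a * (v - u) / (v * u)" using True by (simp add: field_simps)
    also have "\<dots> \<le> x - y" using h(3) True a_pos by (simp add: field_simps)
    finally have "a / u - a / v \<le> x - y" .
    moreover have "a / u - a / v \<le> (1 / y - 1 / x) * (a / u * (a / v))"
    proof -
      have "a * (v - u) / (v * u) \<le> a * (a * (1 / y - 1 / x)) / (v * u)"
        using h(2) True a_pos by (intro divide_right_mono mult_left_mono) auto
      then show ?thesis by (simp add: diff mult_ac)
    qed
    moreover have "a / v \<le> a / u" using h(1) True a_pos by (simp add: frac_le)
    ultimately have "(a / u, a / v) \<in> sector (x - y) (1 / y - 1 / x)"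
      using True a_pos by (simp add: sector_def mult.commute[of v u])
    then have "(a / u, a / v) \<in> C" using sector_subset[OF assms] by auto
    then show ?thesis
      using preservesD[OF preserves_inversion, of "a / u" "a / v"] True a_pos by simp
  next
    case False
    with that have "u = 0" "v = 0" by (auto simp: sector_def)
    then show ?thesis using diagonal_mem[of x y] assms by simp
  qed
  then show ?thesis using sector_subset[OF assms] by (auto simp: region_def)
qed

lemma Omega_subset:
  assumes "x > 0" "y > 0" "(x, y) \<in> C"
  shows "Omega a x y \<subseteq> C"
proof (cases "x \<ge> y")
  case True
  then show ?thesis using region_subset assms a_pos by (simp add: Omega_eq_region)
next
  case False
  then have "a / y \<le> a / x" using assms a_pos by (simp add: frac_le)
  moreover have "(a / x, a / y) \<in> C" using preservesD[OF preserves_inversion assms] .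
  ultimately show ?thesis
    using region_subset[of "a / y" "a / x"] assms a_pos
    by (simp add: Omega_eq_region flip: Omega_inversion[OF a_pos assms(1,2)])
qed

end

section \<open>The union of the regions is closed and invariant\<close>

text \<open>Once \<open>b ^ n\<close> exceeds both \<open>\<beta>\<close> and
  \<open>1 / \<alpha>\<close>, all such exponents lie between \<open>- n\<close> and
  \<open>n\<close>.\<close>

lemma finite_power_int_bounded:
  fixes b :: real
  assumes "b > 1" "\<alpha> > 0"
  shows "finite {k. \<alpha> \<le> b powi k \<and> b powi k \<le> \<beta>}"
proof -
  obtain n where n: "max \<beta> (1 / \<alpha>) < b ^ n"
    using real_arch_pow[OF assms(1)] by blast
  have "{k. \<alpha> \<le> b powi k \<and> b powi k \<le> \<beta>} \<subseteq> {- int n..int n}"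
  proof
    fix k assume k: "k \<in> {k. \<alpha> \<le> b powi k \<and> b powi k \<le> \<beta>}"
    have "k \<le> int n"
    proof (rule ccontr)
      assume "\<not> k \<le> int n"
      then have "b powi int n \<le> b powi k"
        using assms by (intro power_int_increasing) auto
      with k n show False by simp
    qed
    moreover have "- int n \<le> k"
    proof (rule ccontr)
      assume "\<not> - int n \<le> k"
      then have "b powi k \<le> b powi (- int n)"
        using assms by (intro power_int_increasing) auto
      also have "\<dots> = 1 / b ^ n" by (simp add: power_int_minus field_simps)
      also have "\<dots> < \<alpha>" using n assms by (simp add: field_simps)
      finally show False using k by simp
    qed
    ultimately show "k \<in> {- int n..int n}" by simp
  qed
  then show ?thesis by (rule finite_subset) simp
qed

text \<open>Away from the diagonal the family of sectors is locally finite, and on the diagonal all of them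
  agree.\<close>

lemma closed_Union_sector:
  assumes "b > 1" "d \<ge> 0" "e \<ge> 0"
  shows "closed (\<Union>k::int. sector (b powi k * d) (e / b powi k))"
    (is "closed (\<Union>k. ?F k)")
proof -
  have bpos: "b powi k > 0" for k using assms by simp
  have "(u, v) \<in> (\<Union>k. ?F k)" if uv: "(u, v) \<in> closure (\<Union>k. ?F k)" for u v
  proof -
    have "(\<Union>k. ?F k) \<subseteq> {p. 0 \<le> snd p \<and> snd p \<le> fst p}"
      by (auto simp: sector_def)
    moreover have "closed {p::real\<times>real. 0 \<le> snd p \<and> snd p \<le> fst p}"
      by (intro closed_Collect_conj closed_Collect_le continuous_intros)
    ultimately have "closure (\<Union>k. ?F k) \<subseteq> {p. 0 \<le> snd p \<and> snd p \<le> fst p}"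
      by (rule closure_minimal)
    with uv have "0 \<le> v" "v \<le> u" by auto
    show ?thesis
    proof (cases "u = v")
      case True
      then have "(u, v) \<in> ?F 0" using \<open>0 \<le> v\<close> assms by (auto simp: sector_def)
      then show ?thesis by blast
    next
      case False
      \<comment> \<open>These cut out a neighbourhood of \<open>(u, v)\<close> that is bounded on
        the right and stays away from the diagonal.\<close>
      define \<delta> M where "\<delta> = (u - v) / 2" and "M = u + 1"
      have "\<delta> > 0" "\<delta> < u - v" "M > 0" "u < M"
        using False \<open>v \<le> u\<close> \<open>0 \<le> v\<close> by (auto simp: \<delta>_def M_def field_simps)
      define B where "B = {p::real\<times>real. \<delta> < fst p - snd p} \<inter> {p. fst p < M}"
      have "open B" unfolding B_def
        by (intro open_Int open_Collect_less continuous_intros)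
      have "(u, v) \<in> B" using \<open>\<delta> < u - v\<close> \<open>u < M\<close> by (simp add: B_def)
      \<comment> \<open>Every sector meeting \<open>B\<close> has its index in \<open>K\<close>: the
        difference bound limits \<open>b powi k\<close> from below and the hyperbola bound from
        above. For \<open>d = 0\<close> the set is empty.\<close>
      define K where "K = {k. \<delta> \<le> b powi k * d \<and> b powi k * \<delta> \<le> e * (M * M)}"
      have "finite K"
      proof (cases "d = 0")
        case True
        then show ?thesis using \<open>\<delta> > 0\<close> by (simp add: K_def)
      next
        case False
        with assms have "d > 0" by simp
        then have "K = {k. \<delta> / d \<le> b powi k \<and> b powi k \<le> e * (M * M) / \<delta>}"
          using \<open>\<delta> > 0\<close> by (simp add: K_def field_simps)
        then show ?thesis
          using finite_power_int_bounded[OF assms(1)] \<open>d > 0\<close> \<open>\<delta> > 0\<close> by simp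
      qed
      have sub: "B \<inter> (\<Union>k. ?F k) \<subseteq> (\<Union>k\<in>K. ?F k)"
      proof clarify
        fix p q k assume pq: "(p, q) \<in> B" "(p, q) \<in> ?F k"
        then have h: "\<delta> < p - q" "p < M" "0 \<le> q" "q \<le> p" "p - q \<le> b powi k * d"
          "p - q \<le> e / b powi k * (p * q)"
          by (auto simp: B_def sector_def)
        have "p * q \<le> M * M" using h \<open>M > 0\<close> by (intro mult_mono) auto
        have "b powi k * \<delta> \<le> b powi k * (p - q)"
          using h bpos[of k] by (intro mult_left_mono) auto
        also have "\<dots> \<le> e * (p * q)"
          using mult_left_mono[OF h(6), of "b powi k"] bpos[of k] assms by simp
        also have "\<dots> \<le> e * (M * M)"
          using \<open>p * q \<le> M * M\<close> assms by (intro mult_left_mono) auto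
        finally have "k \<in> K" using h by (simp add: K_def)
        with pq show "(p, q) \<in> (\<Union>k\<in>K. ?F k)" by blast
      qed
      have "(u, v) \<in> closure (B \<inter> (\<Union>k. ?F k))"
        using open_Int_closure_subset[OF \<open>open B\<close>] uv \<open>(u, v) \<in> B\<close> by blast
      also have "\<dots> \<subseteq> (\<Union>k\<in>K. ?F k)"
        using sub \<open>finite K\<close> by (intro closure_minimal closed_UN ballI closed_sector) auto
      finally show ?thesis by blast
    qed
  qed
  then have "closure (\<Union>k. ?F k) \<subseteq> (\<Union>k. ?F k)" by (rule subrelI)
  then show ?thesis by (simp only: closure_subset_eq)
qed

lemma Union_reflect_int: "(\<Union>k::int. A (- k)) = (\<Union>k. A k)"
proof (intro equalityI UN_least)
  show "A (- k) \<subseteq> (\<Union>k. A k)" for k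
    by (rule UN_upper[OF UNIV_I])
  show "A k \<subseteq> (\<Union>k. A (- k))" for k
    using UN_upper[OF UNIV_I, of "\<lambda>k. A (- k)" "- k"] by (simp only: minus_minus)
qed

text \<open>The second halves carry the scaling with opposite exponent; replacing \<open>k\<close>
  by \<open>- k\<close> makes them a family of sectors with constants \<open>a * e\<close> and
  \<open>d / a\<close>.\<close>

lemma closed_Union_region:
  assumes "a > 0" "b > 1" "d \<ge> 0" "e \<ge> 0"
  shows "closed (\<Union>k::int. region a (b powi k * d) (e / b powi k))"
proof -
  have "(\<Union>k::int. sector (a * (e / b powi k)) (b powi k * d / a))
      = (\<Union>k::int. sector (b powi (- k) * (a * e)) ((d / a) / b powi (- k)))"
    by (simp add: power_int_minus field_simps)
  also have "\<dots> = (\<Union>k::int. sector (b powi k * (a * e)) ((d / a) / b powi k))"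
    by (rule Union_reflect_int[where A = "\<lambda>k. sector (b powi k * (a * e)) ((d / a) / b powi k)"])
  finally have "closed (\<Union>k::int. sector (a * (e / b powi k)) (b powi k * d / a))"
    using closed_Union_sector[of b "a * e" "d / a"] assms by simp
  then have "closed (prod.swap -` (\<Union>k::int. sector (a * (e / b powi k)) (b powi k * d / a)))"
    by (intro closed_vimage continuous_on_swap)
  then have "closed ((\<Union>k::int. sector (b powi k * d) (e / b powi k)) \<union>
      prod.swap -` (\<Union>k::int. sector (a * (e / b powi k)) (b powi k * d / a)))"
    using closed_Union_sector assms by (intro closed_Un) auto
  then show ?thesis by (simp add: region_def UN_Un_distrib vimage_UN)
qed

text \<open>\<open>R_map a\<close> reverses order, hence the swap. The hyperbola bound limits the
  new difference \<open>a / v - a / u\<close>; the added 1 only enlarges the product on the right of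
  the new hyperbola bound.\<close>

lemma sector_R:
  assumes "a > 0" "D \<ge> 0" "u > 0" "v > 0" "(u, v) \<in> sector D E"
  shows "(R_map a v, R_map a u) \<in> sector (a * E) (D / a)"
proof -
  have h: "v \<le> u" "u - v \<le> D" "u - v \<le> E * (u * v)"
    using assms by (auto simp: sector_def)
  \<comment> \<open>Since \<open>R_map a x = (x + a) / x\<close>, the estimate rests on
    \<open>a * a \<le> (u + a) * (v + a)\<close>.\<close>
  have "a * a * (u - v) \<le> (u + a) * (v + a) * D"
    using h assms by (intro mult_mono) (auto simp: algebra_simps)
  then have "a * a * (u - v) / (a * (v * u)) \<le> (u + a) * (v + a) * D / (a * (v * u))"
    using assms by (intro divide_right_mono) auto
  moreover have "a * a * (u - v) / (a * (v * u)) = a / v - a / u"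
    using assms by (simp add: field_simps)
  moreover have "(u + a) * (v + a) * D / (a * (v * u)) = D / a * (R_map a v * R_map a u)"
    using assms by (simp add: R_map_def add_divide_distrib[of _ a u, symmetric] field_simps)
  ultimately have "a / v - a / u \<le> D / a * (R_map a v * R_map a u)" by simp
  moreover have "a / v - a / u \<le> a * E"
  proof -
    have "a / v - a / u = a * ((u - v) / (u * v))" using assms by (simp add: field_simps)
    also have "\<dots> \<le> a * E"
      using h(3) assms by (intro mult_left_mono) (auto simp: pos_divide_le_eq)
    finally show ?thesis .
  qed
  moreover have "a / u \<le> a / v" using h assms by (simp add: frac_le)
  ultimately show ?thesis using assms by (auto simp: sector_def R_map_def)
qed

text \<open>The two halves are exchanged with the same \<open>D\<close> and \<open>E\<close>,
  because \<open>(D, E) -> (a * E, D / a)\<close> is an involution.\<close>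

lemma region_R:
  assumes "a > 0" "D \<ge> 0" "E \<ge> 0" "u > 0" "v > 0" "(u, v) \<in> region a D E"
  shows "(R_map a u, R_map a v) \<in> region a D E"
proof (cases "(u, v) \<in> sector D E")
  case True
  then show ?thesis using sector_R assms by (simp add: region_def)
next
  case False
  then have "(v, u) \<in> sector (a * E) (D / a)" using assms by (simp add: region_def)
  then show ?thesis using sector_R[of a "a * E" v u "D / a"] assms by (simp add: region_def)
qed

lemma sector_S:
  assumes "b > 0" "(u, v) \<in> sector D E"
  shows "(S_map b u, S_map b v) \<in> sector (D / b) (b * E)"
  using assms by (auto simp: sector_def S_map_def field_simps)

text \<open>S shifts the index of the two halves of a region in opposite directions.\<close>

lemma region_S:
  assumes "a > 0" "b > 0" "(u, v) \<in> region a D E"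
  shows "(S_map b u, S_map b v) \<in> region a (D / b) (b * E) \<union> region a (b * D) (E / b)"
  using assms sector_S[of b u v D E] sector_S[of b v u "a * E" "D / a"]
  by (auto simp: region_def)

lemma preserves_Union_region:
  assumes "a > 0" "b > 1" "d \<ge> 0" "e \<ge> 0"
  defines "U \<equiv> \<Union>k::int. region a (b powi k * d) (e / b powi k)"
  shows "preserves U (R_map a)" "preserves U (S_map b)"
proof -
  show "preserves U (R_map a)"
    unfolding preserves_def
  proof (intro conjI allI impI)
    fix u v :: real assume "u > 0" "v > 0" "(u, v) \<in> U"
    then obtain k where "(u, v) \<in> region a (b powi k * d) (e / b powi k)"
      by (auto simp: U_def)
    with \<open>u > 0\<close> \<open>v > 0\<close> have "(R_map a u, R_map a v) \<in> region a (b powi k * d) (e / b powi k)"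
      using assms by (intro region_R) auto
    then show "(R_map a u, R_map a v) \<in> U" by (auto simp: U_def)
  qed (use assms in \<open>simp add: R_map_def add_pos_pos\<close>)
  show "preserves U (S_map b)"
    unfolding preserves_def
  proof (intro conjI allI impI)
    fix u v :: real assume "(u, v) \<in> U"
    then obtain k where "(u, v) \<in> region a (b powi k * d) (e / b powi k)"
      by (auto simp: U_def)
    \<comment> \<open>The first half moves to index \<open>k - 1\<close>, the second to
      \<open>k + 1\<close>.\<close>
    then have "(S_map b u, S_map b v) \<in> region a (b powi k * d / b) (b * (e / b powi k))
        \<union> region a (b * (b powi k * d)) (e / b powi k / b)"
      using assms by (intro region_S) auto
    also have "\<dots> = region a (b powi (k - 1) * d) (e / b powi (k - 1))
        \<union> region a (b powi (k + 1) * d) (e / b powi (k + 1))"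
      using assms by (simp add: power_int_diff power_int_add mult_ac)
    finally show "(S_map b u, S_map b v) \<in> U" unfolding U_def by blast
  qed (use assms in \<open>simp add: S_map_def\<close>)
qed

lemma Union_Omega_eq_region:
  assumes "a > 0" "b > 1" "y > 0" "x \<ge> y"
  shows "(\<Union>k::int. Omega a (b powi k * x) (b powi k * y))
       = (\<Union>k::int. region a (b powi k * (x - y)) ((1 / y - 1 / x) / b powi k))"
proof -
  have "Omega a (b powi k * x) (b powi k * y)
      = region a (b powi k * (x - y)) ((1 / y - 1 / x) / b powi k)" for k
  proof -
    have "b powi k > 0" using assms by simp
    then have "Omega a (b powi k * x) (b powi k * y)
        = region a (b powi k * x - b powi k * y) (1 / (b powi k * y) - 1 / (b powi k * x))"
      using assms by (intro Omega_eq_region) auto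
    then show ?thesis by (simp add: algebra_simps diff_divide_distrib)
  qed
  then show ?thesis by simp
qed

text \<open>Inversion reverses the scaling exponent, and the union runs over all integers.\<close>

lemma Union_Omega_inversion:
  assumes "a > 0" "b > 1" "x > 0" "y > 0"
  shows "(\<Union>k::int. Omega a (b powi k * (a / x)) (b powi k * (a / y)))
       = (\<Union>k::int. Omega a (b powi k * x) (b powi k * y))"
proof -
  have "Omega a (b powi k * (a / x)) (b powi k * (a / y))
      = Omega a (b powi (- k) * x) (b powi (- k) * y)" for k
    using assms Omega_inversion[of a "b powi (- k) * x" "b powi (- k) * y"]
    by (simp add: power_int_minus field_simps)
  then show ?thesis
    using Union_reflect_int[of "\<lambda>k. Omega a (b powi k * x) (b powi k * y)"] by simp
qed

lemma Union_Omega_closed_invariant: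
  assumes "a > 0" "b > 1" "x > 0" "y > 0"
  defines "U \<equiv> \<Union>k::int. Omega a (b powi k * x) (b powi k * y)"
  shows "closed U \<and> preserves U (R_map a) \<and> preserves U (S_map b) \<and> U \<subseteq> {0..} \<times> {0..}"
proof -
  \<comment> \<open>Stated for fresh \<open>x\<close>, \<open>y\<close> and \<open>U\<close> so that
    it also applies to the inverted pair when \<open>x < y\<close>.\<close>
  have *: "closed U \<and> preserves U (R_map a) \<and> preserves U (S_map b) \<and> U \<subseteq> {0..} \<times> {0..}"
    if "y > 0" "x \<ge> y" "U = (\<Union>k::int. Omega a (b powi k * x) (b powi k * y))" for x y U
  proof -
    have "1 / y - 1 / x \<ge> 0" using that by (simp add: frac_le)
    then show ?thesis
      using assms(1,2) that closed_Union_region[of a b "x - y" "1 / y - 1 / x"]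
        preserves_Union_region[of a b "x - y" "1 / y - 1 / x"]
      unfolding that(3) Union_Omega_eq_region[OF assms(1,2) that(1,2)]
      by (intro conjI UN_least) (auto simp: region_def sector_def)
  qed
  show ?thesis
  proof (cases "x \<ge> y")
    case True
    then show ?thesis using * assms by blast
  next
    case False
    then have "a / x \<ge> a / y" "a / y > 0" using assms by (auto simp: frac_le)
    then show ?thesis
      using *[of "a / y" "a / x" U] Union_Omega_inversion[of a b x y] assms by simp
  qed
qed

section \<open>The orbit and its closure\<close>

lemma mem_Omega:
  assumes "a > 0" "x > 0" "y > 0"
  shows "(x, y) \<in> Omega a x y"
  using assms by (auto simp: Omega_def Omega_below_def field_simps)

text \<open>Induction over the semigroup; applied both to the union of regions and to the open
  quadrant.\<close>

lemma RS_orbit_subset: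
  assumes "x > 0" "y > 0" "(x, y) \<in> U" "preserves U (R_map a)" "preserves U (S_map b)"
  shows "RS_orbit a b (x, y) \<subseteq> U"
proof -
  have "preserves U h" if "h \<in> RS_semigroup a b" for h
    using that
  proof induction
    case RS_id
    then show ?case by (simp add: preserves_def)
  qed (use assms preserves_comp in \<open>auto simp: o_def\<close>)
  then show ?thesis using assms by (auto simp: RS_orbit_def intro: preservesD)
qed

lemma preserves_RS_orbit:
  assumes "a > 0" "b > 0"
  shows "preserves (RS_orbit a b p) (R_map a)" "preserves (RS_orbit a b p) (S_map b)"
proof -
  have "(g u, g v) \<in> RS_orbit a b p"
    if orbit: "(u, v) \<in> RS_orbit a b p"
      and closed: "\<And>h. h \<in> RS_semigroup a b \<Longrightarrow> g \<circ> h \<in> RS_semigroup a b"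
    for g u v
  proof -
    obtain h where "h \<in> RS_semigroup a b" "u = h (fst p)" "v = h (snd p)"
      using orbit by (auto simp: RS_orbit_def)
    then show ?thesis using closed[of h] unfolding RS_orbit_def
      by (intro CollectI exI[of _ "g \<circ> h"]) simp
  qed
  moreover have "R_map a u > 0" "S_map b u > 0" if "u > 0" for u
    using that assms by (auto simp: R_map_def S_map_def add_pos_pos)
  ultimately show "preserves (RS_orbit a b p) (R_map a)" "preserves (RS_orbit a b p) (S_map b)"
    by (auto simp: preserves_def intro: RS_R RS_S)
qed

theorem theorem3p2:
  fixes a b x y :: real
  assumes "a > 0" and "b > 1" and "x > 0" and "y > 0"
  shows "(top_of_set ({0..} \<times> {0..})) closure_of (RS_orbit a b (x, y))
         = (\<Union>k::int. Omega a (b powi k * x) (b powi k * y))"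
proof -
  define P where "P = RS_orbit a b (x, y)"
  define U where "U = (\<Union>k::int. Omega a (b powi k * x) (b powi k * y))"
  have P: "preserves P (R_map a)" "preserves P (S_map b)"
    using preserves_RS_orbit assms by (auto simp: P_def)
  have U: "closed U" "preserves U (R_map a)" "preserves U (S_map b)" "U \<subseteq> {0..} \<times> {0..}"
    using Union_Omega_closed_invariant[OF assms] by (auto simp: U_def)
  have "(x, y) \<in> Omega a (b powi 0 * x) (b powi 0 * y)" using mem_Omega assms by simp
  then have "(x, y) \<in> U" unfolding U_def by blast
  then have "P \<subseteq> U" unfolding P_def using U assms by (intro RS_orbit_subset) auto
  have Ppos: "P \<subseteq> {0<..} \<times> {0<..}"
    unfolding P_def using assms
    by (intro RS_orbit_subset) (auto simp: preserves_def R_map_def S_map_def add_pos_pos)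
  have xyP: "(x, y) \<in> P"
    unfolding P_def RS_orbit_def using RS_id[of a b] by (auto intro!: exI[of _ id])
  interpret RS_invariant a b "closure P"
  proof
    show "preserves (closure P) (R_map a)"
      using P Ppos by (intro preserves_closure) (auto simp: R_map_def intro!: continuous_intros)
    show "preserves (closure P) (S_map b)"
      using P Ppos assms
      by (intro preserves_closure) (auto simp: S_map_def intro!: continuous_intros)
  qed (use assms in auto)
  have "(b powi k * x, b powi k * y) \<in> closure P" for k
    using preservesD[OF preserves_power_int] assms xyP closure_subset by blast
  then have "U \<subseteq> closure P"
    unfolding U_def using assms by (intro UN_least Omega_subset) auto
  moreover have "closure P \<subseteq> U" using \<open>P \<subseteq> U\<close> U(1) by (rule closure_minimal)
  ultimately have "closure P = U" by blast
  \<comment> \<open>The relative closure is the quadrant intersected with the ordinary closure of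
    this set, which equals \<open>U\<close> and already lies in the quadrant.\<close>
  moreover have "({0..} \<times> {0..}) \<inter> P = P" using \<open>P \<subseteq> U\<close> U(4) by blast
  ultimately show ?thesis
    using U(4) by (auto simp: closure_of_subtopology P_def U_def)
qed

end
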